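(* Let $\lambda\in\mathbb{C}_p$ with $\lambda\ne0$ and $|\lambda|_p\le1$ ($p$ an odd prime), and let $r\in\mathbb{N}$. For every $n\ge0$, \[ \sum_{m=0}^nCh^{(r)}_m(x)\,S_{2,\lambda}(n,m)=\sum_{m=0}^nCh^{(r)}_{m,\lambda}(x)\,S_2(n,m). \]
   Context: $S_2(n,m)$ are the Stirling numbers of the second kind: $x^n=\sum_{m=0}^nS_2(n,m)\,x(x-1)\cdots(x-m+1)$. The degenerate Stirling numbers of the second kind are defined by $\frac1{m!}\big((1+\lambda t)^{1/\lambda}-1\big)^m=\sum_{n\ge m}S_{2,\lambda}(n,m)\frac{t^n}{n!}$ (and $S_{2,\lambda}(n,m)=0$ for $n<m$). The fermionic $p$-adic integral of a continuous $f$ on $\mathbb{Z}_p$ is $\int_{\mathbb{Z}_p}f(y)\,d\mu_{-1}(y)=\lim_{N\to\infty}\sum_{y=0}^{p^N-1}f(y)(-1)^y$. The higher-order Changhee polynomials are $Ch^{(r)}_m(x)=\int_{\mathbb{Z}_p}\cdots\int_{\mathbb{Z}_p}(x_1+\cdots+x_r+x)_m\,d\mu_{-1}(x_1)\cdots d\mu_{-1}(x_r)$, where $(z)_m=z(z-1)\cdots(z-m+1)$; equivalently $\left(\frac{2}{2+t}\right)^r(1+t)^x=\sum_{m\ge0}Ch^{(r)}_m(x)\frac{t^m}{m!}$. Writing $(x)_{0,\lambda}=1$, $(x)_{n,\lambda}=x(x-\lambda)\cdots(x-(n-1)\lambda)$ and $(1+\lambda u)^{x/\lambda}=\sum_{m\ge0}(x)_{m,\lambda}u^m/m!$,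 the higher-order degenerate Changhee polynomials of the second kind are defined by $\left(\frac{2}{1+(1+\lambda\log(1+t))^{1/\lambda}}\right)^r(1+\lambda\log(1+t))^{x/\lambda}=\sum_{n\ge0}Ch^{(r)}_{n,\lambda}(x)\frac{t^n}{n!}$. *)

theory Defs
  imports
    "HOL-Analysis.Analysis"
    "HOL-Computational_Algebra.Formal_Power_Series"
    "HOL-Combinatorics.Stirling"
begin

definition algebraic_elements :: "'a :: field set \<Rightarrow> 'a set" where
  "algebraic_elements F = {z. \<exists>q. q \<noteq> 0 \<and> (\<forall>i. coeff q i \<in> F) \<and> poly q z = 0}"

text \<open>
  The field \<open>\<complex>\<^sub>p\<close> is not in the libraries. The following locale says that the type
  \<open>'a\<close>, with the absolute value \<open>nrm\<close>, is the completion of an algebraic closure of \<open>\<rat>\<^sub>p\<close>,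
  which determines it up to isometric isomorphism.
  Completeness and the topology come from the class \<open>complete_space\<close>, whose metric is required
  to be the one of \<open>nrm\<close>. As \<open>nrm\<close> is the \<open>p\<close>-adic absolute value on the rationals,
  \<open>\<rat>\<^sub>p\<close> is \<open>closure \<rat>\<close>, and its algebraic closure is the set of all
  elements algebraic over it.
\<close>

locale padic_complex_numbers =
  fixes p :: nat
    and nrm :: "'a :: {field_char_0, complete_space} \<Rightarrow> real"
  assumes prime_p: "prime p"
    and dist_eq_nrm: "\<And>x y. dist x y = nrm (x - y)"
    and nrm_mult: "\<And>x y. nrm (x * y) = nrm x * nrm y"
    and nrm_add_le: "\<And>x y. nrm (x + y) \<le> max (nrm x) (nrm y)"
    and nrm_of_int: "\<And>k :: int. k \<noteq> 0 \<Longrightarrow> nrm (of_int k) = (1 / real p) ^ multiplicity (int p) k"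
    and algebraic_closure_closed:
      "\<And>q :: 'a poly. degree q > 0 \<Longrightarrow>
         (\<And>i. coeff q i \<in> algebraic_elements (closure \<rat>)) \<Longrightarrow>
         \<exists>z \<in> algebraic_elements (closure \<rat>). poly q z = 0"
    and algebraic_closure_dense: "closure (algebraic_elements (closure (\<rat> :: 'a set))) = UNIV"

text \<open>
  Only the values of \<open>f\<close> at natural numbers enter the limit, so the integrand, which is a function
  on \<open>\<int>\<^sub>p\<close>, is rendered as a function on the whole field.
\<close>

definition fermionic_integral :: "nat \<Rightarrow> ('a :: {field_char_0, t2_space} \<Rightarrow> 'a) \<Rightarrow> 'a" where
  "fermionic_integral p f = lim (\<lambda>N. \<Sum>y<p ^ N. f (of_nat y) * (- 1) ^ y)"

text \<open>The integrand takes the list \<open>[x\<^sub>1, \<dots>, x\<^sub>r]\<close>; the outermost integral is over \<open>x\<^sub>r\<close>.\<close>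

primrec iterated_fermionic_integral ::
  "nat \<Rightarrow> nat \<Rightarrow> ('a :: {field_char_0, t2_space} list \<Rightarrow> 'a) \<Rightarrow> 'a" where
  "iterated_fermionic_integral p 0 f = f []"
| "iterated_fermionic_integral p (Suc r) f =
     fermionic_integral p (\<lambda>y. iterated_fermionic_integral p r (\<lambda>xs. f (xs @ [y])))"

definition falling_factorial :: "'a :: comm_ring_1 \<Rightarrow> nat \<Rightarrow> 'a" where
  "falling_factorial z m = (\<Prod>i<m. z - of_nat i)"

definition Changhee :: "nat \<Rightarrow> nat \<Rightarrow> nat \<Rightarrow> 'a :: {field_char_0, t2_space} \<Rightarrow> 'a" where
  "Changhee p r m x =
     iterated_fermionic_integral p r (\<lambda>xs. falling_factorial (sum_list xs + x) m)"

text \<open>The formal power series \<open>(1 + \<lambda>t)\<^bsup>x/\<lambda>\<^esup>\<close>.\<close>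

definition degenerate_exp :: "'a :: field_char_0 \<Rightarrow> 'a \<Rightarrow> 'a fps" where
  "degenerate_exp l x = fps_compose (fps_binomial (x / l)) (fps_const l * fps_X)"

lemma degenerate_exp_nth:
  fixes l x :: "'a :: field_char_0"
  assumes "l \<noteq> 0"
  shows "fps_nth (degenerate_exp l x) m = (\<Prod>i<m. x - of_nat i * l) / fact m"
proof -
  have "l ^ m * (\<Prod>i<m. x / l - of_nat i) = (\<Prod>i<m. l * (x / l - of_nat i))"
    by (simp add: prod.distrib)
  also have "\<dots> = (\<Prod>i<m. x - of_nat i * l)"
    using assms by (intro prod.cong) (auto simp: field_simps)
  finally show ?thesis
    by (simp add: degenerate_exp_def fps_compose_linear gbinomial_prod_rev atLeast0LessThan)
qed

definition degenerate_Stirling2 :: "'a :: field_char_0 \<Rightarrow> nat \<Rightarrow> nat \<Rightarrow> 'a" where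
  "degenerate_Stirling2 l n m =
     fact n * fps_nth (fps_const (1 / fact m) * (degenerate_exp l 1 - 1) ^ m) n"

lemma degenerate_Stirling2_less:
  assumes "n < m"
  shows "degenerate_Stirling2 l n m = 0"
proof -
  have "fps_nth (degenerate_exp l 1 - 1) 0 = 0"
    by (simp add: degenerate_exp_def)
  then have "fps_nth ((degenerate_exp l 1 - 1) ^ m) n = 0"
    using assms by (rule startsby_zero_power_prefix[rule_format])
  then show ?thesis
    by (simp add: degenerate_Stirling2_def)
qed

text \<open>In the following, \<open>fps_ln 1\<close> is the series \<open>log (1 + t)\<close>.\<close>

definition degenerate_Changhee2 :: "nat \<Rightarrow> 'a :: field_char_0 \<Rightarrow> nat \<Rightarrow> 'a \<Rightarrow> 'a" where
  "degenerate_Changhee2 r l n x =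
     fact n * fps_nth
       ((2 / (1 + fps_compose (degenerate_exp l 1) (fps_ln 1))) ^ r *
         fps_compose (degenerate_exp l x) (fps_ln 1)) n"

text \<open>The library function \<open>Stirling\<close> is defined by recursion; it satisfies the defining
  identity of the Stirling numbers of the second kind.\<close>

lemma power_eq_sum_Stirling:
  fixes x :: "'a :: comm_ring_1"
  shows "x ^ n = (\<Sum>m\<le>n. of_nat (Stirling n m) * falling_factorial x m)"
proof (induction n)
  case 0
  show ?case by (simp add: falling_factorial_def)
next
  case (Suc n)
  define F where "F = falling_factorial x"
  have x: "x * F m = F (Suc m) + of_nat m * F m" for m
    by (simp add: F_def falling_factorial_def algebra_simps)
  have "x ^ Suc n = (\<Sum>m\<le>n. of_nat (Stirling n m) * (x * F m))"
    by (simp add: Suc.IH F_def sum_distrib_left mult_ac)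
  also have "\<dots> = (\<Sum>m\<le>n. of_nat (Stirling n m) * F (Suc m)) +
                   (\<Sum>m\<le>n. of_nat (m * Stirling n m) * F m)"
    by (simp add: x algebra_simps sum.distrib)
  also have "(\<Sum>m\<le>n. of_nat (m * Stirling n m) * F m) =
             (\<Sum>m\<le>Suc n. of_nat (m * Stirling n m) * F m)"
    by simp
  also have "\<dots> = (\<Sum>m\<le>n. of_nat (Suc m * Stirling n (Suc m)) * F (Suc m))"
    by (subst sum.atMost_Suc_shift) simp
  also have "(\<Sum>m\<le>n. of_nat (Stirling n m) * F (Suc m)) + \<dots> =
             (\<Sum>m\<le>n. of_nat (Stirling (Suc n) (Suc m)) * F (Suc m))"
    by (simp add: algebra_simps sum.distrib)
  also have "\<dots> = (\<Sum>m\<le>Suc n. of_nat (Stirling (Suc n) m) * F m)"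
    by (subst sum.atMost_Suc_shift) simp
  finally show ?case by (simp only: F_def)
qed

end

theory Submission
  imports Defs
begin

text \<open>
  Summing the geometric series shows that the fermionic integral of the coefficients of
  \<open>(1 + t)\<^sup>y G\<close> gives those of \<open>2 / (2 + t) G\<close>, because \<open>(1 + t) ^ p\<^sup>N\<close> tends to \<open>1\<close>
  coefficientwise. Hence the Changhee polynomials have the exponential generating function
  \<open>F(t) = (2 / (2 + t))\<^sup>r (1 + t)\<^sup>x\<close>. With \<open>E(u) = (1 + \<lambda>u)\<^bsup>1/\<lambda>\<^esup>\<close>, the left-hand side is
  the coefficient of \<open>u\<^sup>n / n!\<close> in \<open>F(E(u) - 1) = (2 / (1 + E(u)))\<^sup>r (1 + \<lambda>u)\<^bsup>x/\<lambda>\<^esup>\<close>. The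
  right-hand side is the same coefficient, since \<open>\<Sum>\<^sub>n S\<^sub>2(n, m) u\<^sup>n / n! = (e\<^sup>u - 1)\<^sup>m / m!\<close> and
  the substitution \<open>t = e\<^sup>u - 1\<close> cancels \<open>log (1 + t)\<close>.
\<close>

section \<open>Formal power series\<close>

lemma fps_compose_inverse_distrib:
  fixes f g :: "'a :: field fps"
  assumes "fps_nth f 0 \<noteq> 0" and "fps_nth g 0 = 0"
  shows "fps_compose (inverse f) g = inverse (fps_compose f g)"
proof -
  have "fps_compose f g * fps_compose (inverse f) g = 1"
    using assms by (simp flip: fps_compose_mult_distrib add: inverse_mult_eq_1')
  then show ?thesis
    by (metis fps_inverse_unique)
qed

text \<open>With A = e^u - 1 one has A' = A + 1, so differentiating A^(k+1) yields a recursion for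
  the coefficients that is exactly the recurrence of \<open>Stirling\<close>.\<close>

lemma fps_exp_minus_1_power_nth:
  "fps_nth ((fps_exp 1 - 1 :: 'a :: field_char_0 fps) ^ m) n =
     fact m * of_nat (Stirling n m) / fact n"
proof (induction n arbitrary: m)
  case 0
  show ?case by (cases m) (simp_all add: fps_nth_power_0)
next
  case (Suc n)
  show ?case
  proof (cases m)
    case 0
    then show ?thesis by simp
  next
    case (Suc k)
    define A :: "'a fps" where "A = fps_exp 1 - 1"
    have "fps_deriv A = A + 1"
      by (simp add: A_def)
    then have "fps_deriv (A ^ Suc k) = fps_const (of_nat (Suc k)) * (A ^ Suc k + A ^ k)"
      by (subst fps_deriv_power) (simp add: algebra_simps del: of_nat_Suc)
    then have "of_nat (Suc n) * fps_nth (A ^ Suc k) (Suc n) =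
        of_nat (Suc k) * (fps_nth (A ^ Suc k) n + fps_nth (A ^ k) n)"
      by (metis Suc_eq_plus1 fps_add_nth fps_deriv_nth fps_mult_left_const_nth)
    also have "\<dots> = of_nat (Suc k) * (fact (Suc k) * of_nat (Stirling n (Suc k)) / fact n +
        fact k * of_nat (Stirling n k) / fact n)"
      by (simp only: A_def Suc.IH)
    also have "\<dots> = fact (Suc k) * of_nat (Stirling (Suc n) (Suc k)) / fact n"
      by (simp add: field_simps del: of_nat_Suc) (simp add: algebra_simps)
    finally have "fps_nth (A ^ Suc k) (Suc n) =
        fact (Suc k) * of_nat (Stirling (Suc n) (Suc k)) / fact n / of_nat (Suc n)"
      by (metis mult.commute nonzero_eq_divide_eq of_nat_neq_0)
    also have "\<dots> = fact (Suc k) * of_nat (Stirling (Suc n) (Suc k)) / fact (Suc n)"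
      by (simp only: divide_divide_eq_left fact_Suc mult.commute of_nat_mult)
    finally show ?thesis
      by (simp add: Suc A_def)
  qed
qed

text \<open>Expand H(e^u - 1) in powers of e^u - 1. Only m \<le> n contributes to the coefficient of
  u^n, since the m-th power starts at u^m.\<close>

lemma sum_mult_Stirling:
  fixes H :: "'a :: field_char_0 fps"
  shows "(\<Sum>m=0..n. fact m * fps_nth H m * of_nat (Stirling n m)) =
    fact n * fps_nth (fps_compose H (fps_exp 1 - 1)) n"
  by (simp add: fps_compose_nth fps_exp_minus_1_power_nth sum_distrib_left mult_ac)

lemma sum_mult_degenerate_Stirling2:
  "(\<Sum>m=0..n. fact m * fps_nth F m * degenerate_Stirling2 l n m) =
    fact n * fps_nth (fps_compose F (degenerate_exp l 1 - 1)) n"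
  by (simp add: fps_compose_nth degenerate_Stirling2_def sum_distrib_left mult_ac)

lemma fps_compose_fps_ln_fps_exp:
  fixes H :: "'a :: field_char_0 fps"
  shows "fps_compose (fps_compose H (fps_ln 1)) (fps_exp 1 - 1) = H"
proof -
  have "fps_compose (fps_ln 1) (fps_exp 1 - 1 :: 'a fps) = fps_X"
    by (simp add: fps_ln_fps_exp_inv fps_inv)
  then show ?thesis
    by (simp flip: fps_compose_assoc)
qed

text \<open>The differential equation is kept free of denominators so that it can be substituted
  into directly.\<close>

lemma fps_binomial_ODE:
  fixes c :: "'a :: field_char_0"
  shows "(1 + fps_X) * fps_deriv (fps_binomial c) = fps_const c * fps_binomial c"
proof -
  have "(1 + fps_X :: 'a fps) * inverse (1 + fps_X) = 1"
    by (simp add: inverse_mult_eq_1')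
  then show ?thesis
    by (simp add: fps_binomial_deriv fps_divide_unit mult.left_commute)
qed

text \<open>This is ((1 + t)^c)^x = (1 + t)^(c x). Both sides have constant term 1 and satisfy (1 +
  t) f' = c x f, which determines f.\<close>

lemma fps_binomial_compose_fps_binomial:
  fixes c x :: "'a :: field_char_0"
  shows "fps_compose (fps_binomial x) (fps_binomial c - 1) = fps_binomial (c * x)"
proof -
  define B where "B = fps_binomial c"
  define f where "f = fps_compose (fps_binomial x) (B - 1)"
  define D where "D = fps_compose (fps_deriv (fps_binomial x)) (B - 1)"
  have B0: "fps_nth (B - 1) 0 = 0"
    by (simp add: B_def)
  \<comment> \<open>Substituting B - 1 turns the factor 1 + t into B; comparing with the
    differential equation of \<open>fps_binomial x\<close> then gives B D = x f.\<close>
  have "fps_compose ((1 + fps_X) * fps_deriv (fps_binomial x)) (B - 1) = B * D"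
    using B0 by (simp add: fps_compose_mult_distrib fps_compose_add_distrib D_def)
  then have D: "B * D = fps_const x * f"
    using B0 by (simp add: fps_binomial_ODE fps_compose_mult_distrib f_def)
  have "(1 + fps_X) * fps_deriv f = D * ((1 + fps_X) * fps_deriv B)"
    using B0 by (simp add: f_def D_def fps_compose_deriv mult_ac)
  also have "\<dots> = fps_const (c * x) * f"
    unfolding B_def fps_binomial_ODE
    using D by (simp add: B_def mult_ac flip: fps_const_mult)
  finally have "(1 + fps_X) * fps_deriv f = fps_const (c * x) * f" .
  moreover have "1 + fps_X \<noteq> (0 :: 'a fps)"
  proof
    assume "1 + fps_X = (0 :: 'a fps)"
    then have "fps_nth (1 + fps_X :: 'a fps) 0 = 0"
      by simp
    then show False
      by simp
  qed
  ultimately have "fps_deriv f = fps_const (c * x) * f / (1 + fps_X)"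
    by (metis nonzero_mult_div_cancel_left)
  moreover have "fps_nth f 0 = 1"
    by (simp add: f_def)
  ultimately have "f = fps_binomial (c * x)"
    by (simp add: fps_binomial_ODE_unique'[symmetric])
  then show ?thesis
    by (simp add: f_def B_def)
qed

text \<open>The preceding composition rule with c = 1/\<lambda>, followed by the rescaling t =
  \<lambda> u.\<close>

lemma fps_binomial_compose_degenerate_exp:
  "fps_compose (fps_binomial x) (degenerate_exp l 1 - 1) = degenerate_exp l x"
proof -
  have "degenerate_exp l 1 - 1 =
      fps_compose (fps_binomial (1 / l) - 1) (fps_const l * fps_X)"
    by (simp add: degenerate_exp_def fps_compose_sub_distrib)
  then have "fps_compose (fps_binomial x) (degenerate_exp l 1 - 1) =
      fps_compose (fps_compose (fps_binomial x) (fps_binomial (1 / l) - 1)) (fps_const l * fps_X)"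
    by (simp add: fps_compose_assoc)
  then show ?thesis
    by (simp add: fps_binomial_compose_fps_binomial degenerate_exp_def)
qed

lemma falling_factorial_eq_gbinomial:
  fixes z :: "'a :: field_char_0"
  shows "falling_factorial z m = fact m * (z gchoose m)"
  by (simp add: falling_factorial_def gbinomial_prod_rev atLeast0LessThan)

text \<open>The sign is absorbed into a geometric series of ratio -(1 + t), so that the denominator
  is 2 + t; oddness of q makes the final power enter with a plus sign.\<close>

lemma sum_alternating_fps_binomial:
  fixes G :: "'a :: field_char_0 fps"
  assumes "odd q"
  shows "(\<Sum>y<q. fps_nth (fps_binomial (of_nat y) * G) m * (- 1) ^ y) =
    fps_nth (G * inverse (2 + fps_X) * (1 + (1 + fps_X) ^ q)) m"
proof -
  define S :: "'a fps" where "S = (\<Sum>y<q. (- (1 + fps_X)) ^ y)"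
  have "(2 + fps_X) * S = (1 - (- (1 + fps_X))) * S"
    by simp
  also have "\<dots> = 1 - (- (1 + fps_X)) ^ q"
    unfolding S_def by (rule one_diff_power_eq[symmetric])
  also have "\<dots> = 1 + (1 + fps_X) ^ q"
    using assms by (simp add: power_minus_odd del: minus_add_distrib)
  finally have "inverse (2 + fps_X) * (1 + (1 + fps_X) ^ q) = inverse (2 + fps_X) * (2 + fps_X) * S"
    by (simp add: mult.assoc)
  also have "\<dots> = S"
    by (subst inverse_mult_eq_1) simp_all
  finally have S: "inverse (2 + fps_X) * (1 + (1 + fps_X) ^ q) = S" .
  have "fps_nth (fps_binomial (of_nat y) * G) m * (- 1) ^ y =
      fps_nth (G * (- (1 + fps_X)) ^ y) m" for y
  proof -
    have "(- (1 + fps_X)) ^ y = fps_const ((- 1) ^ y) * (1 + fps_X :: 'a fps) ^ y"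
      by (subst power_minus) (simp flip: fps_const_power fps_const_neg)
    then have "G * (- (1 + fps_X)) ^ y = fps_const ((- 1) ^ y) * (fps_binomial (of_nat y) * G)"
      by (simp add: fps_binomial_of_nat mult_ac)
    then show ?thesis
      by (simp only: fps_mult_left_const_nth mult.commute)
  qed
  then have "(\<Sum>y<q. fps_nth (fps_binomial (of_nat y) * G) m * (- 1) ^ y) =
      fps_nth (G * S) m"
    by (simp add: S_def sum_distrib_left fps_sum_nth)
  then show ?thesis
    by (simp only: S mult.assoc)
qed

section \<open>The fermionic integral\<close>

context padic_complex_numbers
begin

lemma nrm_eq_dist: "nrm x = dist x 0"
  by (simp add: dist_eq_nrm)

lemma nrm_zero [simp]: "nrm 0 = 0"
  and nrm_eq_0_iff [simp]: "nrm x = 0 \<longleftrightarrow> x = 0"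
  and nrm_nonneg [simp]: "0 \<le> nrm x"
  by (simp_all add: nrm_eq_dist)

lemma nrm_sum_le: "nrm (\<Sum>i\<in>A. f i) \<le> (\<Sum>i\<in>A. nrm (f i))"
proof (induction A rule: infinite_finite_induct)
  case (insert a A)
  have "nrm (f a + sum f A) \<le> max (nrm (f a)) (nrm (sum f A))"
    by (rule nrm_add_le)
  also have "\<dots> \<le> nrm (f a) + (\<Sum>i\<in>A. nrm (f i))"
    using insert.IH by (simp add: sum_nonneg add_increasing)
  finally show ?case
    using insert.hyps by simp
qed simp_all

lemma nrm_of_nat_le_1: "nrm (of_nat k) \<le> 1"
proof (cases "k = 0")
  case False
  then have "nrm (of_nat k) = (1 / real p) ^ multiplicity (int p) (int k)"
    using nrm_of_int[of "int k"] by simp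
  also have "\<dots> \<le> 1"
    using prime_gt_0_nat[OF prime_p] by (intro power_le_one) auto
  finally show ?thesis .
qed simp

lemma nrm_of_nat_prime_power: "nrm (of_nat (p ^ N)) = (1 / real p) ^ N"
proof -
  have "multiplicity (int p) (int p ^ N) = N"
    using prime_p by (intro multiplicity_same_power) (auto simp: prime_gt_0_nat)
  then show ?thesis
    using nrm_of_int[of "int p ^ N"] prime_gt_0_nat[OF prime_p] by simp
qed

text \<open>Take absolute values in the absorption identity k C(q, k) = q C(q - 1, k - 1); the last
  factor is an integer, hence of absolute value at most 1.\<close>

lemma nrm_binomial_le:
  assumes "0 < k"
  shows "nrm (of_nat (q choose k)) \<le> nrm (of_nat q) / nrm (of_nat k)"
proof -
  have "of_nat k * of_nat (q choose k) = (of_nat q * of_nat (q - 1 choose (k - 1)) :: 'a)"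
    using times_binomial_minus1_eq[OF assms, of q] by (metis of_nat_mult)
  then have "nrm (of_nat k) * nrm (of_nat (q choose k)) =
      nrm (of_nat q) * nrm (of_nat (q - 1 choose (k - 1)))"
    by (metis nrm_mult)
  also have "\<dots> \<le> nrm (of_nat q)"
    by (simp add: mult_left_le nrm_of_nat_le_1)
  finally have "nrm (of_nat k) * nrm (of_nat (q choose k)) \<le> nrm (of_nat q)" .
  moreover have "0 < nrm (of_nat k)"
    using assms nrm_nonneg[of "of_nat k"]
    by (metis less_irrefl nrm_eq_0_iff of_nat_eq_0_iff order_le_less)
  ultimately show ?thesis
    by (simp only: pos_le_divide_eq mult.commute)
qed

lemma nrm_prime_power_binomial_tendsto_0:
  assumes "0 < k"
  shows "(\<lambda>N. nrm (of_nat (p ^ N choose k))) \<longlonglongrightarrow> 0"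
proof (rule tendsto_sandwich[OF _ _ tendsto_const])
  have "(\<lambda>N. (1 / real p) ^ N / nrm (of_nat k)) \<longlonglongrightarrow> 0 / nrm (of_nat k)"
    using prime_gt_1_nat[OF prime_p] assms by (intro tendsto_intros LIMSEQ_realpow_zero) auto
  then show "(\<lambda>N. (1 / real p) ^ N / nrm (of_nat k)) \<longlonglongrightarrow> 0"
    by simp
  have "nrm (of_nat (p ^ N choose k)) \<le> (1 / real p) ^ N / nrm (of_nat k)" for N
    using nrm_binomial_le[OF assms, of "p ^ N"] by (simp only: nrm_of_nat_prime_power)
  then show "\<forall>\<^sub>F N in sequentially.
      nrm (of_nat (p ^ N choose k)) \<le> (1 / real p) ^ N / nrm (of_nat k)"
    by (intro always_eventually allI)
  show "\<forall>\<^sub>F N in sequentially. 0 \<le> nrm (of_nat (p ^ N choose k))"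
    by (intro always_eventually allI nrm_nonneg)
qed

text \<open>The partial sums are coefficients of W (1 + (1 + t)^q) with q = p^N. They differ from
  those of 2 W by a finite combination of the C(q, i) with i > 0, all of which tend to 0. This
  convergence also identifies the value of \<open>lim\<close>.\<close>

lemma fermionic_integral_fps_binomial_mult:
  fixes G :: "'a fps"
  assumes "odd p"
  shows "fermionic_integral p (\<lambda>y. fps_nth (fps_binomial y * G) m) =
    fps_nth (2 / (2 + fps_X) * G) m"
  unfolding fermionic_integral_def
proof (rule limI)
  define W where "W = G * inverse (2 + fps_X)"
  have limit: "2 / (2 + fps_X) * G = W * 2"
    by (simp add: W_def fps_divide_unit)
  have bound: "nrm (fps_nth (W * (1 + (1 + fps_X) ^ q)) m - fps_nth (W * 2) m) \<le>
      (\<Sum>i=1..m. nrm (fps_nth W (m - i)) * nrm (of_nat (q choose i)))" for q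
  proof -
    define V :: "'a fps" where "V = (1 + fps_X) ^ q - 1"
    \<comment> \<open>The constant coefficient vanishes, so the sum below can start at i = 1, where
      the binomial coefficients become small.\<close>
    have V: "fps_nth V i = (if i = 0 then 0 else of_nat (q choose i))" for i
      by (simp add: V_def binomial_gbinomial flip: fps_binomial_of_nat)
    have "W * (1 + (1 + fps_X) ^ q) - W * 2 = V * W"
      by (simp add: V_def algebra_simps)
    then have "fps_nth (W * (1 + (1 + fps_X) ^ q)) m - fps_nth (W * 2) m = fps_nth (V * W) m"
      by (metis fps_sub_nth)
    also have "\<dots> = (\<Sum>i=1..m. of_nat (q choose i) * fps_nth W (m - i))"
      by (simp add: fps_mult_nth V sum.atLeast_Suc_atMost)
    finally show ?thesis
      using nrm_sum_le[of "\<lambda>i. of_nat (q choose i) * fps_nth W (m - i)" "{1..m}"]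
      by (simp add: nrm_mult mult.commute)
  qed
  have "(\<lambda>N. \<Sum>i=1..m. nrm (fps_nth W (m - i)) * nrm (of_nat (p ^ N choose i))) \<longlonglongrightarrow> 0"
    by (intro tendsto_null_sum tendsto_mult_right_zero nrm_prime_power_binomial_tendsto_0) auto
  then have "(\<lambda>N. nrm (fps_nth (W * (1 + (1 + fps_X) ^ p ^ N)) m - fps_nth (W * 2) m)) \<longlonglongrightarrow> 0"
    by (rule tendsto_sandwich[OF _ _ tendsto_const, rotated 2]) (simp_all add: bound del: One_nat_def)
  then have "(\<lambda>N. fps_nth (W * (1 + (1 + fps_X) ^ p ^ N)) m) \<longlonglongrightarrow> fps_nth (W * 2) m"
    by (subst tendsto_dist_iff) (simp add: dist_eq_nrm)
  then show "(\<lambda>N. \<Sum>y<p ^ N. fps_nth (fps_binomial (of_nat y) * G) m * (- 1) ^ y)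
      \<longlonglongrightarrow> fps_nth (2 / (2 + fps_X) * G) m"
    using assms by (simp add: sum_alternating_fps_binomial limit W_def)
qed

text \<open>Each integration contributes one factor 2 / (2 + t). The series G is arbitrary so that
  it can absorb the factor (1 + t)^y of the outermost variable, which is fixed during the inner
  integrations.\<close>

lemma iterated_fermionic_integral_fps_binomial_mult:
  fixes G :: "'a fps"
  assumes "odd p"
  shows "iterated_fermionic_integral p r (\<lambda>xs. fps_nth (fps_binomial (sum_list xs) * G) m) =
    fps_nth ((2 / (2 + fps_X)) ^ r * G) m"
proof (induction r arbitrary: G)
  case 0
  show ?case by simp
next
  case (Suc r)
  have "iterated_fermionic_integral p r
        (\<lambda>xs. fps_nth (fps_binomial (sum_list (xs @ [y])) * G) m) =
      fps_nth (fps_binomial y * ((2 / (2 + fps_X)) ^ r * G)) m" for y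
    using Suc.IH[of "fps_binomial y * G"]
    by (simp add: fps_binomial_add_mult mult_ac)
  then show ?case
    using fermionic_integral_fps_binomial_mult[OF assms, of "(2 / (2 + fps_X)) ^ r * G" m]
    by (simp add: mult.assoc)
qed

text \<open>The integrand is m! times the coefficient of t^m in (1 + t)^(x_1 + ... + x_r) (1 + t)^x,
  so G is m! (1 + t)^x.\<close>

lemma Changhee_eq:
  fixes x :: 'a
  assumes "odd p"
  shows "Changhee p r m x = fact m * fps_nth ((2 / (2 + fps_X)) ^ r * fps_binomial x) m"
proof -
  have integrand: "falling_factorial (sum_list xs + x) m =
      fps_nth (fps_binomial (sum_list xs) * (fps_const (fact m) * fps_binomial x)) m" for xs
  proof -
    have "fps_binomial (sum_list xs) * (fps_const (fact m) * fps_binomial x) =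
        fps_const (fact m) * fps_binomial (sum_list xs + x)"
      by (simp only: fps_binomial_add_mult mult.left_commute)
    then show ?thesis
      by (simp only: falling_factorial_eq_gbinomial fps_mult_left_const_nth fps_binomial_nth)
  qed
  have "Changhee p r m x =
      fps_nth ((2 / (2 + fps_X)) ^ r * (fps_const (fact m) * fps_binomial x)) m"
    unfolding Changhee_def integrand
    by (rule iterated_fermionic_integral_fps_binomial_mult[OF assms])
  then show ?thesis
    by (simp only: mult.left_commute[of _ "fps_const _"] fps_mult_left_const_nth)
qed

end

theorem theorem2p11:
  fixes p r n :: nat
    and nrm :: "'a :: {field_char_0, complete_space} \<Rightarrow> real"
    and l x :: 'a
  assumes "padic_complex_numbers p nrm"
    and "odd p"
    and "l \<noteq> 0"
    and "nrm l \<le> 1"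
  shows "(\<Sum>m=0..n. Changhee p r m x * degenerate_Stirling2 l n m) =
         (\<Sum>m=0..n. degenerate_Changhee2 r l m x * of_nat (Stirling n m))"
proof -
  interpret padic_complex_numbers p nrm by fact
  define E where "E = degenerate_exp l 1"
  define F where "F = (2 / (2 + fps_X)) ^ r * fps_binomial x"
  define H where "H = (2 / (1 + E)) ^ r * degenerate_exp l x"
  have E0: "fps_nth E 0 = 1"
    by (simp add: E_def degenerate_exp_def)
  \<comment> \<open>A nonzero constant term makes A invertible, so the quotient is a product with
    \<open>inverse A\<close>. Both 2 + t and 1 + E have constant term 2.\<close>
  have quotient: "fps_compose (2 / A) g = 2 / fps_compose A g"
    if "fps_nth A 0 = 2" "fps_nth g 0 = 0" for A g :: "'a fps"
    using that by (simp add: fps_divide_unit fps_compose_mult_distrib fps_compose_inverse_distrib)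
  \<comment> \<open>Under t = E - 1 the series 2 + t becomes 1 + E, and (1 + t)^x becomes
    \<open>degenerate_exp l x\<close>.\<close>
  have "fps_compose F (E - 1) = H"
    using E0 by (simp add: F_def H_def fps_compose_mult_distrib quotient fps_compose_add_distrib
        fps_binomial_compose_degenerate_exp flip: fps_compose_power E_def)
      (simp add: E_def fps_binomial_compose_degenerate_exp)
  then have "(\<Sum>m=0..n. Changhee p r m x * degenerate_Stirling2 l n m) = fact n * fps_nth H n"
    by (simp add: Changhee_eq[OF \<open>odd p\<close>] sum_mult_degenerate_Stirling2 flip: F_def E_def)
  \<comment> \<open>The second family is generated by H at log(1 + t); summing against
    \<open>Stirling\<close> substitutes e^u - 1 and restores H.\<close>
  moreover have "degenerate_Changhee2 r l m x = fact m * fps_nth (fps_compose H (fps_ln 1)) m" for m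
    using E0 by (simp add: degenerate_Changhee2_def H_def fps_compose_mult_distrib quotient
        fps_compose_add_distrib flip: fps_compose_power E_def)
  ultimately show ?thesis
    by (simp add: sum_mult_Stirling fps_compose_fps_ln_fps_exp)
qed

end
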